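(* Let $S(t)$, for $t$ in an interval $I\ni 0$ of smooth existence, be a smooth one-parameter family of closed, oriented hypersurfaces in $\mathbb{R}^{n+1}$, evolving by a smooth velocity field $\mathbf{V}$ with no self-intersections and no topological events (no pinch-offs, no attachments). Then for all $t\in I$ the Euler characteristic is constant: $$\chi(S(t))=\chi(S(0)).$$
   Context: "Closed" means compact without boundary. The evolution is described by a smooth position field $\mathbf{R}(s,t)\in\mathbb{R}^{n+1}$, which for each fixed $t$ is an embedding with image the $n$-dimensional hypersurface $S(t)$, and $\mathbf{V}=\partial_t\mathbf{R}$ is the velocity. $\chi$ denotes the Euler characteristic. *)

theory Defs
  imports "HOL-Analysis.Analysis" "HOL-Homology.Homology"
begin

section \<open>Smooth maps between subsets of Euclidean spaces\<close>

text \<open>Only meaningful for open \<open>U\<close>. In finite dimension, continuity of all iterated directional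
  derivatives of a differentiable map amounts to continuity of its iterated Frechet derivatives.\<close>

primrec Ck_on ::
    "nat \<Rightarrow> ('a::euclidean_space \<Rightarrow> 'b::euclidean_space) \<Rightarrow> 'a set \<Rightarrow> bool" where
  "Ck_on 0 f U \<longleftrightarrow> continuous_on U f"
| "Ck_on (Suc k) f U \<longleftrightarrow>
     (\<forall>x\<in>U. f differentiable (at x)) \<and> (\<forall>v. Ck_on k (\<lambda>x. frechet_derivative f (at x) v) U)"

text \<open>Smoothness on an arbitrary set means local extendability to a smooth map on an open set.
  The generality is needed for time intervals with end points and for subsets of a linear
  subspace.\<close>

definition smooth_on ::
    "('a::euclidean_space \<Rightarrow> 'b::euclidean_space) \<Rightarrow> 'a set \<Rightarrow> bool" where
  "smooth_on f A \<longleftrightarrow>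
     (\<forall>x\<in>A. \<exists>U g. open U \<and> x \<in> U \<and> (\<forall>k. Ck_on k g U) \<and> (\<forall>y\<in>A \<inter> U. f y = g y))"


section \<open>Closed smooth manifolds\<close>

text \<open>The model space of an \<open>n\<close>-manifold is an \<open>n\<close>-dimensional linear subspace \<open>W\<close> of a Euclidean
  space. The choice \<open>W = UNIV\<close> gives the usual charts; subspaces are admitted because every type of
  class \<^class>\<open>euclidean_space\<close> has positive dimension, which would exclude \<open>n = 0\<close>.

  A chart is a pair of a domain and a coordinate map.\<close>

definition chart_of :: "'e::euclidean_space set \<Rightarrow> 's topology \<Rightarrow> 's set \<times> ('s \<Rightarrow> 'e) \<Rightarrow> bool" where
  "chart_of W M = (\<lambda>(U, \<phi>). openin M U \<and> openin (top_of_set W) (\<phi> ` U) \<and>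
     homeomorphic_map (subtopology M U) (top_of_set (\<phi> ` U)) \<phi>)"

definition smooth_atlas ::
    "'e::euclidean_space set \<Rightarrow> 's topology \<Rightarrow> ('s set \<times> ('s \<Rightarrow> 'e)) set \<Rightarrow> bool" where
  "smooth_atlas W M \<A> \<longleftrightarrow>
     (\<forall>c\<in>\<A>. chart_of W M c) \<and> (\<Union>(U, \<phi>)\<in>\<A>. U) = topspace M \<and>
     (\<forall>(U, \<phi>)\<in>\<A>. \<forall>(U', \<psi>)\<in>\<A>. smooth_on (\<psi> \<circ> inv_into U \<phi>) (\<phi> ` (U \<inter> U')))"

text \<open>There is no boundary because charts take values in (relatively) open subsets of \<open>W\<close>.\<close>

definition closed_smooth_manifold ::
    "nat \<Rightarrow> 'e::euclidean_space set \<Rightarrow> 's topology \<Rightarrow> ('s set \<times> ('s \<Rightarrow> 'e)) set \<Rightarrow> bool" where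
  "closed_smooth_manifold n W M \<A> \<longleftrightarrow>
     subspace W \<and> dim W = n \<and>
     Hausdorff_space M \<and> second_countable M \<and> compact_space M \<and> smooth_atlas W M \<A>"


section \<open>Evolving hypersurfaces\<close>

text \<open>Derivatives are taken within \<open>\<phi> ` U\<close>, which is open in \<open>W\<close>; they are thus determined exactly
  on \<open>W\<close>, and only their restriction to \<open>W\<close> is used.\<close>

definition smooth_embedding ::
    "'e::euclidean_space set \<Rightarrow> 's topology \<Rightarrow> ('s set \<times> ('s \<Rightarrow> 'e)) set \<Rightarrow>
     ('s \<Rightarrow> 'b::euclidean_space) \<Rightarrow> bool" where
  "smooth_embedding W M \<A> f \<longleftrightarrow>
     (\<forall>(U, \<phi>)\<in>\<A>. smooth_on (f \<circ> inv_into U \<phi>) (\<phi> ` U) \<and>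
        (\<forall>s\<in>U. \<exists>D. ((f \<circ> inv_into U \<phi>) has_derivative D) (at (\<phi> s) within \<phi> ` U) \<and> inj_on D W)) \<and>
     embedding_map M euclidean f"

text \<open>Joint smoothness of a field on \<open>M \<times> I\<close>.\<close>

definition smooth_field ::
    "('s set \<times> ('s \<Rightarrow> 'e::euclidean_space)) set \<Rightarrow> real set \<Rightarrow>
     ('s \<Rightarrow> real \<Rightarrow> 'b::euclidean_space) \<Rightarrow> bool" where
  "smooth_field \<A> I F \<longleftrightarrow>
     (\<forall>(U, \<phi>)\<in>\<A>. smooth_on (\<lambda>(x, t). F (inv_into U \<phi> x) t) (\<phi> ` U \<times> I))"

text \<open>A hypersurface is oriented by a unit normal field, here pulled back to the parameter manifold
  along the embedding \<open>f\<close>.\<close>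

definition unit_normal ::
    "'e::euclidean_space set \<Rightarrow> ('s set \<times> ('s \<Rightarrow> 'e)) set \<Rightarrow>
     ('s \<Rightarrow> 'b::euclidean_space) \<Rightarrow> ('s \<Rightarrow> 'b) \<Rightarrow> bool" where
  "unit_normal W \<A> f N \<longleftrightarrow>
     (\<forall>(U, \<phi>)\<in>\<A>. \<forall>s\<in>U. norm (N s) = 1 \<and>
        (\<forall>D. ((f \<circ> inv_into U \<phi>) has_derivative D) (at (\<phi> s) within \<phi> ` U) \<longrightarrow>
             (\<forall>w\<in>W. N s \<bullet> D w = 0)))"


section \<open>Euler characteristic\<close>

definition int_independent :: "('a, 'b) monoid_scheme \<Rightarrow> 'a set \<Rightarrow> bool" where
  "int_independent G B \<longleftrightarrow>
     (\<forall>c::'a \<Rightarrow> int. finprod G (\<lambda>b. b [^]\<^bsub>G\<^esub> c b) B = \<one>\<^bsub>G\<^esub> \<longrightarrow> (\<forall>b\<in>B. c b = 0))"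

text \<open>The rank of an abelian group (written multiplicatively), when it is finite.\<close>

definition abelian_rank :: "('a, 'b) monoid_scheme \<Rightarrow> nat" where
  "abelian_rank G = Sup (card ` {B. finite B \<and> B \<subseteq> carrier G \<and> int_independent G B})"

definition betti_number :: "nat \<Rightarrow> 'a topology \<Rightarrow> nat" where
  "betti_number p X = abelian_rank (homology_group (int p) X)"

text \<open>The alternating sum of the ranks of integral singular homology. It is used for spaces with
  finitely many nonzero Betti numbers, all of them finite, such as closed manifolds.\<close>

definition euler_characteristic :: "'a topology \<Rightarrow> int" where
  "euler_characteristic X = (\<Sum>p | betti_number p X \<noteq> 0. (-1) ^ p * int (betti_number p X))"

end

theory Submission
  imports Defs
begin

text \<open>For each \<open>t \<in> I\<close> the position map \<open>\<lambda>s. R s t\<close> is an embedding, so its image \<open>S t\<close> is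
  homeomorphic to the parameter manifold \<open>M\<close>. Hence \<open>S t\<close> and \<open>S 0\<close> have the same Euler
  characteristic as the single space \<open>M\<close>. The exclusion of topological events is contained in
  the fact that the parameter manifold does not depend on \<open>t\<close>.

  It remains that the Euler characteristic is a topological invariant. A homeomorphism induces
  isomorphisms of the homology groups, and the rank of an abelian group is invariant under
  isomorphism because an injective homomorphism maps independent sets to independent sets of the
  same size (lemma \<open>int_independent_image\<close>).\<close>

lemma hom_finprod_comm_group:
  assumes "comm_group G" "comm_group H" "h \<in> hom G H" "f \<in> A \<rightarrow> carrier G"
  shows "h (finprod G f A) = finprod H (\<lambda>x. h (f x)) A"
proof -
  interpret G: comm_group G by fact
  interpret H: comm_group H by fact
  interpret group_hom G H h
    using assms(3) by unfold_locales
  show ?thesis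
    using assms(4)
  proof (induction A rule: infinite_finite_induct)
    case (insert a A)
    then have "f a \<in> carrier G" "f \<in> A \<rightarrow> carrier G" by auto
    moreover from this have "(\<lambda>x. h (f x)) \<in> A \<rightarrow> carrier H"
      by (intro Pi_I hom_closed) auto
    ultimately show ?case
      using insert by simp
  qed auto
qed

text \<open>An integer relation among the images is the image under \<open>h\<close> of the relation in \<open>G\<close> with the same
  coefficients; since \<open>h\<close> is injective, that relation already holds in \<open>G\<close>.\<close>

lemma int_independent_image:
  assumes G: "comm_group G" and H: "comm_group H" and h: "h \<in> mon G H"
    and B: "B \<subseteq> carrier G" "int_independent G B"
  shows "int_independent H (h ` B)"
  unfolding int_independent_def
proof (intro allI impI)
  interpret G: comm_group G by fact
  interpret H: comm_group H by fact
  have hom: "h \<in> hom G H" and inj: "inj_on h (carrier G)"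
    using h by (auto simp: mon_def)
  interpret group_hom G H h
    using hom by unfold_locales
  fix c :: "_ \<Rightarrow> int"
  assume c: "finprod H (\<lambda>b. b [^]\<^bsub>H\<^esub> c b) (h ` B) = \<one>\<^bsub>H\<^esub>"
  let ?x = "finprod G (\<lambda>b. b [^]\<^bsub>G\<^esub> c (h b)) B"
  have x: "?x \<in> carrier G"
    using B(1) by (intro G.finprod_closed) auto
  have "h ?x = finprod H (\<lambda>b. h (b [^]\<^bsub>G\<^esub> c (h b))) B"
    using B(1) by (intro hom_finprod_comm_group[OF G H hom]) auto
  also have "\<dots> = finprod H (\<lambda>b. h b [^]\<^bsub>H\<^esub> c (h b)) B"
    using B(1) by (intro H.finprod_cong') (auto simp: hom_int_pow)
  also have "\<dots> = finprod H (\<lambda>b. b [^]\<^bsub>H\<^esub> c b) (h ` B)"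
    using B(1) by (intro H.finprod_reindex[symmetric]) (auto intro: inj_on_subset[OF inj])
  finally have "h ?x = h \<one>\<^bsub>G\<^esub>"
    using c by simp
  then have "?x = \<one>\<^bsub>G\<^esub>"
    using inj_onD[OF inj _ x] by auto
  then show "\<forall>b\<in>h ` B. c b = 0"
    using spec[OF B(2)[unfolded int_independent_def], of "\<lambda>b. c (h b)"] by auto
qed

text \<open>On natural numbers \<open>Sup\<close> is the least upper bound only for bounded sets, and homology groups of
  arbitrary spaces can have infinite rank. Comparing the sets of cardinalities instead of their
  suprema makes the invariance of the rank hold without a case distinction.\<close>

lemma independent_cards_subset:
  assumes G: "comm_group G" and H: "comm_group H" and "G \<cong> H"
  shows "card ` {B. finite B \<and> B \<subseteq> carrier G \<and> int_independent G B}
    \<subseteq> card ` {B. finite B \<and> B \<subseteq> carrier H \<and> int_independent H B}"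
proof clarify
  fix B assume B: "finite B" "B \<subseteq> carrier G" "int_independent G B"
  obtain h where "h \<in> iso G H"
    using \<open>G \<cong> H\<close> by (auto simp: is_iso_def)
  then have h: "h \<in> mon G H"
    by (simp add: iso_iff_mon_epi)
  then have "inj_on h B"
    using B(2) by (auto simp: mon_def intro: inj_on_subset)
  moreover have "h ` B \<subseteq> carrier H"
    using h B(2) by (auto simp: mon_def hom_def)
  ultimately show "card B \<in> card ` {B. finite B \<and> B \<subseteq> carrier H \<and> int_independent H B}"
    using int_independent_image[OF G H h B(2,3)] B(1)
    by (intro image_eqI[of _ _ "h ` B"]) (auto simp: card_image)
qed

lemma abelian_rank_iso:
  assumes G: "comm_group G" and H: "comm_group H" and iso: "G \<cong> H"
  shows "abelian_rank G = abelian_rank H"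
proof -
  have "H \<cong> G"
    using iso comm_group.axioms(2)[OF G] by (rule group.iso_sym[rotated])
  then show ?thesis
    unfolding abelian_rank_def
    using independent_cards_subset[OF G H iso] independent_cards_subset[OF H G]
    by (metis subset_antisym)
qed

lemma euler_characteristic_homeomorphic:
  assumes "X homeomorphic_space Y"
  shows "euler_characteristic X = euler_characteristic Y"
proof -
  have "betti_number p X = betti_number p Y" for p
    unfolding betti_number_def
    using homeomorphic_space_imp_isomorphic_homology_groups[OF assms]
    by (intro abelian_rank_iso abelian_homology_group)
  then show ?thesis
    by (simp add: euler_characteristic_def)
qed

theorem theorem2p27:
  fixes n :: nat
    and W :: "'e::euclidean_space set"
    and M :: "'s topology"
    and \<A> :: "('s set \<times> ('s \<Rightarrow> 'e)) set"
    and I :: "real set"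
    and R V N :: "'s \<Rightarrow> real \<Rightarrow> real ^ 'd"
    and S :: "real \<Rightarrow> (real ^ 'd) set"
  assumes ambient: "CARD('d) = n + 1"
    and parameter_manifold: "closed_smooth_manifold n W M \<A>"
    and interval: "is_interval I" "0 \<in> I"
    and position: "smooth_field \<A> I R"
    and embedding: "\<And>t. t \<in> I \<Longrightarrow> smooth_embedding W M \<A> (\<lambda>s. R s t)"
    and hypersurface: "\<And>t. t \<in> I \<Longrightarrow> S t = (\<lambda>s. R s t) ` topspace M"
    and orientation: "smooth_field \<A> I N"
      "\<And>t. t \<in> I \<Longrightarrow> unit_normal W \<A> (\<lambda>s. R s t) (\<lambda>s. N s t)"
    and velocity: "smooth_field \<A> I V"
      "\<And>s t. s \<in> topspace M \<Longrightarrow> t \<in> I \<Longrightarrow>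
         ((\<lambda>\<tau>. R s \<tau>) has_vector_derivative V s t) (at t within I)"
  shows "\<forall>t\<in>I. euler_characteristic (top_of_set (S t)) = euler_characteristic (top_of_set (S 0))"
proof
  have homeo: "M homeomorphic_space top_of_set (S t)" if "t \<in> I" for t
    using embedding_map_imp_homeomorphic_space[of M euclidean "\<lambda>s. R s t"]
      embedding[OF that] hypersurface[OF that]
    by (simp add: smooth_embedding_def)
  fix t assume "t \<in> I"
  then show "euler_characteristic (top_of_set (S t)) = euler_characteristic (top_of_set (S 0))"
    using euler_characteristic_homeomorphic[OF homeo] interval(2) by metis
qed

end
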